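(* Let $M(t)=(m_{ij}(t))_{1\le i,j\le4}$ be a matrix with identity valuation pattern, with expansions $$m_{ii}(t)=t a_i+O(t^2)\quad(a_i\in k^* ),\qquad m_{ij}(t)=u_{ij}+t w_{ij}+O(t^2)\quad (i\ne j,\ u_{ij}\in k^*,\ w_{ij}\in k).$$ Then $$\det M(t)=\Theta_4(U)+t\,\Psi_4(U,A,W)+O(t^2),$$ where $\Theta_4(U)=\sum_{\sigma\in D_4}\mathrm{sgn}(\sigma)\prod_{r=1}^4u_{r,\sigma(r)}$ and $$\Psi_4(U,A,W):=\sum_{i=1}^4 a_iD_i(U)+\sum_{\sigma\in D_4}\mathrm{sgn}(\sigma)\Bigl(\prod_{r=1}^4u_{r,\sigma(r)}\Bigr)\Bigl(\sum_{r=1}^4\frac{w_{r,\sigma(r)}}{u_{r,\sigma(r)}}\Bigr).$$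
   Context: $K$ is a discretely valued field with uniformizer $t$ of valuation $1$ and residue field $k$ identified with a coefficient subfield of the valuation ring (e.g. $K=k((t))$); $O(t^2)$ denotes an element of valuation at least $2$. $D_4\subset S_4$ is the set of derangements. $A=(a_1,\dots,a_4)$, $U=(u_{ij})_{i\ne j}$, $W=(w_{ij})_{i\neq j}$. For $i\in\{1,2,3,4\}$ with $\{j,k,\ell\}=\{1,2,3,4\}\setminus\{i\}$, $D_i(U):=u_{jk}u_{k\ell}u_{\ell j}+u_{j\ell}u_{\ell k}u_{kj}$ (independent of how the three remaining indices are named). A matrix has identity valuation pattern if its diagonal entries have valuation $1$ and its off-diagonal entries have valuation $0$. *)

theory Defs
  imports "HOL-Analysis.Analysis"
begin

locale discretely_valued_field =
  fixes v :: "'a::field \<Rightarrow> ereal"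
  assumes v_eq_infinity_iff: "v x = \<infinity> \<longleftrightarrow> x = 0"
    and v_integral: "x \<noteq> 0 \<Longrightarrow> \<exists>n::int. v x = ereal (real_of_int n)"
    and v_mult: "v (x * y) = v x + v y"
    and v_add: "v (x + y) \<ge> min (v x) (v y)"
    and v_normalized: "\<exists>x. v x = 1"

definition valuation_ring :: "('a::field \<Rightarrow> ereal) \<Rightarrow> 'a set" where
  "valuation_ring v = {x. v x \<ge> 0}"

text \<open>
  The residue field is realised as the set of residue classes of the valuation ring modulo its
  maximal ideal.  A coefficient field is a subfield of the valuation ring that the residue map
  sends bijectively onto the residue field.
\<close>

definition residue_class :: "('a::field \<Rightarrow> ereal) \<Rightarrow> 'a \<Rightarrow> 'a set" where
  "residue_class v x = {y \<in> valuation_ring v. v (y - x) > 0}"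

definition residue_field :: "('a::field \<Rightarrow> ereal) \<Rightarrow> 'a set set" where
  "residue_field v = residue_class v ` valuation_ring v"

definition is_subfield :: "'a::field set \<Rightarrow> bool" where
  "is_subfield k \<longleftrightarrow> 1 \<in> k \<and> (\<forall>x\<in>k. \<forall>y\<in>k. x - y \<in> k \<and> x * y \<in> k) \<and> (\<forall>x\<in>k. inverse x \<in> k)"

definition coefficient_field :: "('a::field \<Rightarrow> ereal) \<Rightarrow> 'a set \<Rightarrow> bool" where
  "coefficient_field v k \<longleftrightarrow>
     is_subfield k \<and> k \<subseteq> valuation_ring v \<and> bij_betw (residue_class v) k (residue_field v)"

definition identity_valuation_pattern :: "('a::field \<Rightarrow> ereal) \<Rightarrow> 'a^4^4 \<Rightarrow> bool" where
  "identity_valuation_pattern v M \<longleftrightarrow> (\<forall>i j. v (M $ i $ j) = (if i = j then 1 else 0))"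

definition derangements :: "('n \<Rightarrow> 'n) set" where
  "derangements = {p. p permutes UNIV \<and> (\<forall>i. p i \<noteq> i)}"

text \<open>
  The index type \<^typ>\<open>4\<close> has elements \<open>1, 2, 3, 4\<close> with arithmetic modulo 4, so \<open>i + 1, i + 2, i + 3\<close> are
  the three indices other than \<open>i\<close>; by \<open>D_eq\<close> below the order in which they are named is irrelevant.
  The families \<open>u, w\<close> indexed by pairs \<open>i \<noteq> j\<close> are total functions whose diagonal values are never used.
\<close>

definition D :: "(4 \<Rightarrow> 4 \<Rightarrow> 'a::field) \<Rightarrow> 4 \<Rightarrow> 'a" where
  "D u i = (let j = i + 1; k = i + 2; l = i + 3 in
     u j k * u k l * u l j + u j l * u l k * u k j)"

lemma D_eq:
  assumes "{j, k, l} = UNIV - {i}"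
  shows "D u i = u j k * u k l * u l j + u j l * u l k * u k j"
proof -
  have "card {j, k, l} = 3"
    unfolding assms by (simp add: card_Diff_singleton)
  then have "j \<noteq> k" "j \<noteq> l" "k \<noteq> l"
    by (auto simp: card_insert_if split: if_splits)
  moreover have "{i + 1, i + 2, i + 3} = UNIV - {i}"
    unfolding UNIV_4 using exhaust_4[of i] by auto
  with assms have "j \<in> {i + 1, i + 2, i + 3}" "k \<in> {i + 1, i + 2, i + 3}" "l \<in> {i + 1, i + 2, i + 3}"
    by auto
  ultimately show ?thesis
    by (elim insertE emptyE; simp add: D_def Let_def algebra_simps)
qed

definition Theta :: "(4 \<Rightarrow> 4 \<Rightarrow> 'a::field) \<Rightarrow> 'a" where
  "Theta u = (\<Sum>\<sigma>\<in>derangements. of_int (sign \<sigma>) * (\<Prod>r\<in>UNIV. u r (\<sigma> r)))"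

definition Psi :: "(4 \<Rightarrow> 4 \<Rightarrow> 'a::field) \<Rightarrow> (4 \<Rightarrow> 'a) \<Rightarrow> (4 \<Rightarrow> 4 \<Rightarrow> 'a) \<Rightarrow> 'a" where
  "Psi u a w = (\<Sum>i\<in>UNIV. a i * D u i) +
     (\<Sum>\<sigma>\<in>derangements. of_int (sign \<sigma>) * (\<Prod>r\<in>UNIV. u r (\<sigma> r)) *
        (\<Sum>r\<in>UNIV. w r (\<sigma> r) / u r (\<sigma> r)))"

end

theory Submission
  imports Defs
begin

text \<open>
  Modulo elements of valuation at least 2, each term of the Leibniz expansion is a product of
  factors \<open>b + t c\<close> with \<open>b = 0\<close> on the diagonal, so it equals
  \<open>\<Prod>b + t \<Sum>\<^sub>r c\<^sub>r \<Prod>\<^sub>s\<^sub>\<noteq>\<^sub>r b\<^sub>s\<close>.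
  Only derangements contribute to the constant term and to the part of the linear term that involves
  \<open>w\<close>.  The coefficient of \<open>a\<^sub>r\<close> is the determinant of the zero-diagonal matrix \<open>u\<close>
  with its \<open>r\<close>-th row replaced by a unit vector, which is \<open>D\<^sub>r\<close>.
\<close>

section \<open>Valuation estimates and first-order expansion\<close>

context discretely_valued_field
begin

lemma v_zero: "v 0 = \<infinity>"
  by (simp add: v_eq_infinity_iff)

lemma v_one: "v 1 = 0"
proof -
  \<comment> \<open>An integer value rules out \<infinity>, so \<open>v 1 = v 1 + v 1\<close> can be
    cancelled.\<close>
  obtain n :: int where n: "v 1 = ereal (real_of_int n)"
    using v_integral[of 1] by auto
  have "v 1 = v 1 + v 1"
    using v_mult[of 1 1] by simp
  then show ?thesis
    using n by (simp add: zero_ereal_def)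
qed

lemma v_neg_one: "v (- 1) = 0"
proof -
  obtain n :: int where n: "v (- 1) = ereal (real_of_int n)"
    using v_integral[of "- 1"] by auto
  have "0 = v (- 1) + v (- 1)"
    using v_mult[of "- 1" "- 1"] v_one by simp
  then show ?thesis
    using n by (simp add: zero_ereal_def)
qed

lemma v_sign: "v (of_int (sign p)) = 0"
  by (simp add: sign_def v_one v_neg_one)

lemma v_add_ge: "c \<le> v x \<Longrightarrow> c \<le> v y \<Longrightarrow> c \<le> v (x + y)"
  using v_add[of x y] by (meson min.boundedI order_trans)

lemma v_mult_ge: "0 \<le> v x \<Longrightarrow> c \<le> v y \<Longrightarrow> c \<le> v (x * y)"
  using add_mono[of 0 "v x" c "v y"] by (simp add: v_mult)

lemma v_sum_ge: "(\<And>i. i \<in> S \<Longrightarrow> c \<le> v (f i)) \<Longrightarrow> c \<le> v (sum f S)"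
  by (induction S rule: infinite_finite_induct) (auto simp: v_zero intro: v_add_ge)

lemma v_prod_nonneg: "(\<And>i. i \<in> S \<Longrightarrow> 0 \<le> v (f i)) \<Longrightarrow> 0 \<le> v (prod f S)"
  by (induction S rule: infinite_finite_induct) (auto simp: v_one intro: v_mult_ge)

text \<open>Induction on \<open>S\<close> by the product rule. The linear term omits a factor
  instead of dividing by it, so the \<open>b i\<close> may vanish, as they will on the
  diagonal.\<close>

lemma v_prod_first_order:
  assumes t: "v t = 1"
    and b: "\<And>i. i \<in> S \<Longrightarrow> 0 \<le> v (b i)"
    and c: "\<And>i. i \<in> S \<Longrightarrow> 0 \<le> v (c i)"
    and f: "\<And>i. i \<in> S \<Longrightarrow> 2 \<le> v (f i - (b i + t * c i))"
    and "finite S"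
  shows "2 \<le> v (prod f S - (prod b S + t * (\<Sum>r\<in>S. c r * prod b (S - {r}))))"
  using \<open>finite S\<close> b c f
proof (induction S)
  case empty
  then show ?case by (simp add: v_zero)
next
  case (insert x S)
  define q where "q = (\<Sum>r\<in>S. c r * prod b (S - {r}))"
  define e where "e = f x - (b x + t * c x)"
  define d where "d = prod f S - (prod b S + t * q)"
  have bS: "0 \<le> v (prod b S)"
    using insert.prems by (intro v_prod_nonneg) auto
  have q: "0 \<le> v q"
    unfolding q_def using insert.prems by (intro v_sum_ge v_mult_ge v_prod_nonneg) auto
  have e: "2 \<le> v e" and d: "2 \<le> v d"
    unfolding e_def d_def q_def using insert by auto
  have bx: "0 \<le> v (b x)" and cx: "0 \<le> v (c x)"
    using insert.prems by auto
  have tt: "2 \<le> v (t * t)" and t0: "0 \<le> v t" and d0: "0 \<le> v d"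
    using t order_trans[OF _ d, of 0] by (simp_all add: v_mult)
  \<comment> \<open>Deleting \<open>r\<close> from \<open>insert x S\<close> keeps \<open>x\<close>,
    so each summand gains the factor \<open>b x\<close>.\<close>
  have "(\<Sum>r\<in>S. c r * prod b (insert x S - {r})) = (\<Sum>r\<in>S. b x * (c r * prod b (S - {r})))"
  proof (rule sum.cong)
    fix r assume r: "r \<in> S"
    with insert.hyps have "insert x S - {r} = insert x (S - {r})" by auto
    with insert.hyps show "c r * prod b (insert x S - {r}) = b x * (c r * prod b (S - {r}))"
      by simp
  qed simp
  then have q': "(\<Sum>r\<in>insert x S. c r * prod b (insert x S - {r})) = c x * prod b S + b x * q"
    using insert.hyps by (simp add: q_def sum_distrib_left)
  have fx: "f x = b x + t * c x + e" and fS: "prod f S = prod b S + t * q + d"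
    by (simp_all add: e_def d_def)
  \<comment> \<open>The exact remainder of multiplying out \<open>fx\<close> and \<open>fS\<close>:
    each summand is an integral element times \<open>t * t\<close>, \<open>e\<close> or
    \<open>d\<close>, all of valuation at least 2.\<close>
  have "prod f (insert x S) - (prod b (insert x S) + t * (c x * prod b S + b x * q))
      = (c x * q) * (t * t) + (prod b S + t * q + d) * e + (b x + t * c x) * d"
    using insert.hyps by (simp add: fx fS algebra_simps)
  moreover have "2 \<le> v \<dots>"
    by (intro v_add_ge v_mult_ge[OF v_mult_ge[OF cx q] tt] v_mult_ge[OF _ e] v_mult_ge[OF _ d]
        v_mult_ge bS q bx cx t0 d0)
  ultimately show ?case
    unfolding q' by simp
qed

text \<open>The product expansion applies to each Leibniz term separately; signs have valuation 0,
  so summing the errors loses nothing.\<close>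

lemma v_det_first_order:
  fixes M :: "'a^'n^'n"
  assumes t: "v t = 1"
    and b: "\<And>i j. 0 \<le> v (b i j)"
    and c: "\<And>i j. 0 \<le> v (c i j)"
    and M: "\<And>i j. 2 \<le> v (M $ i $ j - (b i j + t * c i j))"
  shows "2 \<le> v (det M - ((\<Sum>p | p permutes UNIV. of_int (sign p) * (\<Prod>r\<in>UNIV. b r (p r))) +
      t * (\<Sum>p | p permutes UNIV. of_int (sign p) *
        (\<Sum>r\<in>UNIV. c r (p r) * (\<Prod>s\<in>UNIV - {r}. b s (p s))))))"
proof -
  have "det M - ((\<Sum>p | p permutes UNIV. of_int (sign p) * (\<Prod>r\<in>UNIV. b r (p r))) +
      t * (\<Sum>p | p permutes UNIV. of_int (sign p) *
        (\<Sum>r\<in>UNIV. c r (p r) * (\<Prod>s\<in>UNIV - {r}. b s (p s)))))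
    = (\<Sum>p | p permutes UNIV. of_int (sign p) * ((\<Prod>r\<in>UNIV. M $ r $ p r) -
        ((\<Prod>r\<in>UNIV. b r (p r)) + t * (\<Sum>r\<in>UNIV. c r (p r) * (\<Prod>s\<in>UNIV - {r}. b s (p s))))))"
    unfolding det_def sum_distrib_left[of t] sum.distrib[symmetric] sum_subtractf[symmetric]
    by (intro sum.cong refl) (simp add: right_diff_distrib distrib_left mult.left_commute
        sum_distrib_left[of t])
  moreover have "2 \<le> v \<dots>"
    by (intro v_sum_ge v_mult_ge v_prod_first_order t b c M) (simp_all add: v_sign)
  ultimately show ?thesis by simp
qed

end

section \<open>Permutation sums and explicit determinants\<close>

lemma sum_permutations_derangements:
  fixes f :: "('n::finite \<Rightarrow> 'n) \<Rightarrow> 'b::comm_monoid_add"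
  assumes "\<And>p i. p permutes UNIV \<Longrightarrow> p i = i \<Longrightarrow> f p = 0"
  shows "(\<Sum>p | p permutes UNIV. f p) = sum f derangements"
  using assms by (intro sum.mono_neutral_right) (auto simp: derangements_def finite_permutations)

lemma det_4:
  fixes A :: "'a::comm_ring_1^4^4"
  shows "det A =
    A$1$1 * (A$2$2 * (A$3$3 * A$4$4 - A$3$4 * A$4$3) - A$2$3 * (A$3$2 * A$4$4 - A$3$4 * A$4$2)
      + A$2$4 * (A$3$2 * A$4$3 - A$3$3 * A$4$2))
    - A$1$2 * (A$2$1 * (A$3$3 * A$4$4 - A$3$4 * A$4$3) - A$2$3 * (A$3$1 * A$4$4 - A$3$4 * A$4$1)
      + A$2$4 * (A$3$1 * A$4$3 - A$3$3 * A$4$1))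
    + A$1$3 * (A$2$1 * (A$3$2 * A$4$4 - A$3$4 * A$4$2) - A$2$2 * (A$3$1 * A$4$4 - A$3$4 * A$4$1)
      + A$2$4 * (A$3$1 * A$4$2 - A$3$2 * A$4$1))
    - A$1$4 * (A$2$1 * (A$3$2 * A$4$3 - A$3$3 * A$4$2) - A$2$2 * (A$3$1 * A$4$3 - A$3$3 * A$4$1)
      + A$2$3 * (A$3$1 * A$4$2 - A$3$2 * A$4$1))"
proof -
  have f: "finite {2::4, 3, 4}" "1 \<notin> {2::4, 3, 4}" "finite {3::4, 4}" "2 \<notin> {3::4, 4}"
    "finite {4::4}" "3 \<notin> {4::4}"
    by auto
  show ?thesis
    unfolding det_def UNIV_4
    \<comment> \<open>A permutation is a transposition moving the first index followed by the choice
      on the rest; peeling off 1, 2 and 3 in turn enumerates all 24.\<close>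
    unfolding sum_over_permutations_insert[OF f(1,2)]
    unfolding sum_over_permutations_insert[OF f(3,4)]
    unfolding sum_over_permutations_insert[OF f(5,6)]
    unfolding permutes_sing
    by (simp add: sign_swap_id permutation_swap_id permutation_compose sign_compose sign_id
        swap_id_eq,
        simp only: diff_conv_add_uminus minus_add_distrib minus_minus distrib_left
        mult_minus_left mult_minus_right ac_simps)
qed

text \<open>The unit row leaves a principal 3 by 3 minor with zero diagonal. The derangements of
  three indices are the two 3-cycles, both even, hence two products with sign +.\<close>

lemma det_unit_row_eq_D:
  fixes u :: "4 \<Rightarrow> 4 \<Rightarrow> 'a::field"
  shows "det (\<chi> i j. if i = r then (if j = r then 1 else 0) else if i = j then 0 else u i j) = D u r"
proof -
  have D: "D u 1 = u 2 3 * u 3 4 * u 4 2 + u 2 4 * u 4 3 * u 3 2"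
    "D u 2 = u 1 3 * u 3 4 * u 4 1 + u 1 4 * u 4 3 * u 3 1"
    "D u 3 = u 1 2 * u 2 4 * u 4 1 + u 1 4 * u 4 2 * u 2 1"
    "D u 4 = u 1 2 * u 2 3 * u 3 1 + u 1 3 * u 3 2 * u 2 1"
    \<comment> \<open>\<open>D_eq\<close> allows the increasing naming of the indices and avoids
      arithmetic modulo 4.\<close>
    by (rule D_eq, unfold UNIV_4, force)+
  show ?thesis
    using exhaust_4[of r] by (elim disjE) (simp_all add: det_4 D algebra_simps)
qed

section \<open>The constant and linear coefficients\<close>

lemma permutation_sum_diagonal_coeff:
  fixes u :: "4 \<Rightarrow> 4 \<Rightarrow> 'a::field"
  shows "(\<Sum>p | p permutes UNIV. of_int (sign p) *
      ((if p r = r then 1 else 0) * (\<Prod>s\<in>UNIV - {r}. if s = p s then 0 else u s (p s)))) = D u r"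
  unfolding det_unit_row_eq_D[symmetric] det_def
  \<comment> \<open>The indicator is the row \<open>r\<close> factor of the Leibniz term of the
    unit-row matrix.\<close>
  by (intro sum.cong refl) (simp add: prod.remove[of UNIV r])

text \<open>The summands are split by whether \<open>p\<close> fixes the distinguished row
  \<open>r\<close>: \<open>diag\<close> collects the \<open>a r\<close>, \<open>off\<close> the
  \<open>w r (p r)\<close>.\<close>

lemma linear_coeff_eq_Psi:
  fixes u w :: "4 \<Rightarrow> 4 \<Rightarrow> 'a::field"
  assumes u: "\<And>i j. i \<noteq> j \<Longrightarrow> u i j \<noteq> 0"
  defines "b \<equiv> \<lambda>i j. if i = j then 0 else u i j"
  shows "(\<Sum>p | p permutes UNIV. of_int (sign p) *
      (\<Sum>r\<in>UNIV. (if r = p r then a r else w r (p r)) * (\<Prod>s\<in>UNIV - {r}. b s (p s)))) = Psi u a w"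
proof -
  define diag where "diag p = (\<Sum>r\<in>UNIV. a r * ((if p r = r then 1 else 0) *
    (\<Prod>s\<in>UNIV - {r}. b s (p s))))" for p
  define off where "off p = (\<Sum>r\<in>UNIV. (if p r = r then 0 else w r (p r)) *
    (\<Prod>s\<in>UNIV - {r}. b s (p s)))" for p
  have "(\<Sum>p | p permutes UNIV. of_int (sign p) * diag p) =
      (\<Sum>r\<in>UNIV. a r * (\<Sum>p | p permutes UNIV. of_int (sign p) *
        ((if p r = r then 1 else 0) * (\<Prod>s\<in>UNIV - {r}. b s (p s)))))"
    unfolding diag_def sum_distrib_left
    by (subst sum.swap) (simp only: mult.left_commute)
  then have diag: "(\<Sum>p | p permutes UNIV. of_int (sign p) * diag p) = (\<Sum>r\<in>UNIV. a r * D u r)"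
    unfolding b_def permutation_sum_diagonal_coeff .
  have "off p = 0" if "p i = i" for p i
    unfolding off_def
  proof (intro sum.neutral ballI)
    fix r
    \<comment> \<open>Here \<open>i \<noteq> r\<close>, since \<open>p\<close> fixes
      \<open>i\<close> but not \<open>r\<close>; so the zero factor \<open>b i i\<close> survives
      the removal of row \<open>r\<close>.\<close>
    have "(\<Prod>s\<in>UNIV - {r}. b s (p s)) = 0" if "p r \<noteq> r"
      using that \<open>p i = i\<close> by (intro prod_zero bexI[of _ i]) (auto simp: b_def)
    then show "(if p r = r then 0 else w r (p r)) * (\<Prod>s\<in>UNIV - {r}. b s (p s)) = 0"
      by auto
  qed
  then have "(\<Sum>p | p permutes UNIV. of_int (sign p) * off p) =
      (\<Sum>p\<in>derangements. of_int (sign p) * off p)"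
    by (intro sum_permutations_derangements) simp
  also have "\<dots> = (\<Sum>p\<in>derangements. of_int (sign p) * (\<Prod>r\<in>UNIV. u r (p r)) *
      (\<Sum>r\<in>UNIV. w r (p r) / u r (p r)))"
  proof (rule sum.cong)
    fix p :: "4 \<Rightarrow> 4" assume "p \<in> derangements"
    \<comment> \<open>Both orientations are recorded: \<open>off\<close> tests
      \<open>p r = r\<close>, while \<open>b\<close> tests \<open>s = p s\<close>.\<close>
    then have p: "p i \<noteq> i" "i \<noteq> p i" for i
      by (metis (mono_tags, lifting) derangements_def mem_Collect_eq)+
    \<comment> \<open>Omitting row \<open>r\<close> amounts to dividing by \<open>u r (p r)\<close>,
      which is nonzero as \<open>p\<close> moves \<open>r\<close>.\<close>
    have "(\<Prod>s\<in>UNIV. u s (p s)) * (w r (p r) / u r (p r)) =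
        w r (p r) * (\<Prod>s\<in>UNIV - {r}. u s (p s))" for r
      using u[OF p(2)[of r]] by (simp add: prod.remove[of UNIV r])
    then have "off p = (\<Prod>r\<in>UNIV. u r (p r)) * (\<Sum>r\<in>UNIV. w r (p r) / u r (p r))"
      by (simp add: off_def b_def p sum_distrib_left)
    then show "of_int (sign p) * off p = of_int (sign p) * (\<Prod>r\<in>UNIV. u r (p r)) *
      (\<Sum>r\<in>UNIV. w r (p r) / u r (p r))"
      by (simp add: mult.assoc)
  qed simp
  finally have off: "(\<Sum>p | p permutes UNIV. of_int (sign p) * off p) = \<dots>" .
  have "(\<Sum>r\<in>UNIV. (if r = p r then a r else w r (p r)) * (\<Prod>s\<in>UNIV - {r}. b s (p s))) =
      diag p + off p" for p
    unfolding diag_def off_def sum.distrib[symmetric] by (intro sum.cong) auto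
  then show ?thesis
    by (simp add: distrib_left sum.distrib diag off Psi_def)
qed

lemma constant_coeff_eq_Theta:
  "(\<Sum>p | p permutes UNIV. of_int (sign p) * (\<Prod>r\<in>UNIV. if r = p r then 0 else u r (p r))) = Theta u"
proof -
  have "(\<Sum>p | p permutes UNIV. of_int (sign p) * (\<Prod>r\<in>UNIV. if r = p r then 0 else u r (p r))) =
      (\<Sum>p\<in>derangements. of_int (sign p) * (\<Prod>r\<in>UNIV. if r = p r then 0 else u r (p r)))"
  proof (rule sum_permutations_derangements)
    fix p :: "4 \<Rightarrow> 4" and i assume "p i = i"
    then have "(\<Prod>r\<in>UNIV. if r = p r then 0 else u r (p r)) = 0"
      by (intro prod_zero bexI[of _ i]) auto
    then show "of_int (sign p) * (\<Prod>r\<in>UNIV. if r = p r then 0 else u r (p r)) = 0"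
      by simp
  qed
  also have "\<dots> = Theta u"
    unfolding Theta_def derangements_def
    by (intro sum.cong prod.cong refl arg_cong2[where f = "(*)"]) (auto dest: sym)
  finally show ?thesis .
qed

theorem lemma4p15:
  fixes v :: "'a::field \<Rightarrow> ereal" and t :: 'a and k :: "'a set"
    and M :: "'a^4^4" and a :: "4 \<Rightarrow> 'a" and u w :: "4 \<Rightarrow> 4 \<Rightarrow> 'a"
  assumes "discretely_valued_field v"
    and "v t = 1"
    and "coefficient_field v k"
    and "identity_valuation_pattern v M"
    and "\<And>i. a i \<in> k - {0}"
    and "\<And>i j. i \<noteq> j \<Longrightarrow> u i j \<in> k - {0}"
    and "\<And>i j. i \<noteq> j \<Longrightarrow> w i j \<in> k"
    and "\<And>i. v (M $ i $ i - t * a i) \<ge> 2"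
    and "\<And>i j. i \<noteq> j \<Longrightarrow> v (M $ i $ j - (u i j + t * w i j)) \<ge> 2"
  shows "v (det M - (Theta u + t * Psi u a w)) \<ge> 2"
proof -
  interpret discretely_valued_field v by fact
  \<comment> \<open>Zero constant terms and the \<open>a i\<close> on the diagonal bring all entries
    to the form \<open>b + t c\<close>, and discard the arbitrary values \<open>u i i\<close> and
    \<open>w i i\<close>.\<close>
  define b where "b i j = (if i = j then 0 else u i j)" for i j
  define c where "c i j = (if i = j then a i else w i j)" for i j
  have k: "0 \<le> v x" if "x \<in> k" for x
    using assms(3) that by (auto simp: coefficient_field_def valuation_ring_def)
  have "0 \<le> v (b i j)" "0 \<le> v (c i j)" "2 \<le> v (M $ i $ j - (b i j + t * c i j))" for i j
    using assms(5-9) by (auto simp: b_def c_def v_zero intro: k)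
  from v_det_first_order[of t b c M, OF assms(2) this]
  have "2 \<le> v (det M -
      ((\<Sum>p | p permutes UNIV. of_int (sign p) * (\<Prod>r\<in>UNIV. if r = p r then 0 else u r (p r))) +
       t * (\<Sum>p | p permutes UNIV. of_int (sign p) *
        (\<Sum>r\<in>UNIV. (if r = p r then a r else w r (p r)) *
          (\<Prod>s\<in>UNIV - {r}. if s = p s then 0 else u s (p s))))))"
    by (simp add: b_def c_def)
  moreover have "u i j \<noteq> 0" if "i \<noteq> j" for i j
    using assms(6)[OF that] by simp
  ultimately show ?thesis
    by (simp add: constant_coeff_eq_Theta linear_coeff_eq_Psi)
qed

end
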